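(* Let $d,\nu\ge 1$ be integers and let $S\subset\{0,1\}^{\Lambda_\nu}$ be a parking scheme. Let $(P_n)_{n\ge 0}$ be the jamming limits of the parking processes on the boxes $\Lambda_n$ with null boundary condition, and let $P$ be the limit algorithm, all defined on $\left((0,1)^{\mathbb{Z}^d},\mathcal{B}_{(0,1)}^{\mathbb{Z}^d},\lambda_{(0,1)}^{\mathbb{Z}^d}\right)$ and taking values in $\{0,1\}^{\mathbb{Z}^d}$. Then, for $\lambda_{(0,1)}^{\mathbb{Z}^d}$-almost every $\omega$, $P_n(\omega)\to P(\omega)$ as $n\to\infty$ in the product topology of $\{0,1\}^{\mathbb{Z}^d}$.
   Context: Probability space: $\Omega=(0,1)^{\mathbb{Z}^d}$ with product Borel $\sigma$-algebra and the product $\lambda_{(0,1)}^{\mathbb{Z}^d}$ of Lebesgue measures on $(0,1)$. The space $\{0,1\}^{\mathbb{Z}^d}$ carries the product of discrete topologies. $|x|_{\sup}=\max_i|x_i|$; $\Lambda_n=\{-n,\dots,n\}^d$. Parking scheme: a subset $S\subset\{0,1\}^{\Lambda_\nu}$ containing the all-zero configuration; $\nu$ is its radius of interaction. Translation: $\theta_x(\eta)(z)=\eta(z+x)$. Parking process on a finite set $X\subset\mathbb{Z}^d$ with null boundary condition: for $\omega\in\Omega$ with pairwise distinct coordinates, start with $\eta=0^{\mathbb{Z}^d}$ and visit the sites of $X$ once each, in increasing order of the values $\omega(x)$; when visiting $x$, if the current configuration $\eta$ satisfies $\theta_x(\eta)|_{\Lambda_\nu}\in S$, then set $\eta(x)=1$,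 otherwise leave $\eta$ unchanged. The final configuration is denoted $P_X(\omega)\in\{0,1\}^{\mathbb{Z}^d}$ (the jamming limit). Put $P_n=P_{\Lambda_n}$. Armour: a path is a finite sequence $(x_i)_{0\le i\le m}$ in $\mathbb{Z}^d$ ($m\ge 0$) with $|x_{i+1}-x_i|_{\sup}\le\nu$ for all $i$; it is decreasing (for $\omega$) if $\omega(x_0)>\omega(x_1)>\dots>\omega(x_m)$. Write $y\uparrow_{(\omega)}x$ if there is a decreasing path from $x_0=x$ to $x_m=y$ (so $x\uparrow_{(\omega)}x$). The armour of $X\subset\mathbb{Z}^d$ is $\mathcal{A}(X)(\omega)=\{y\in\mathbb{Z}^d:\exists x\in X,\ y\uparrow_{(\omega)}x\}$. Limit algorithm: $P(\omega)(x)=P_{\mathcal{A}(\{x\})(\omega)}(\omega)(x)$ for all $x\in\mathbb{Z}^d$. Convention: on the exceptional set of $\omega$ having two equal coordinates, or for which an infinite decreasing path exists (equivalently some $\mathcal{A}(\{x\})(\omega)$ is infinite, when the coordinates are distinct), set $P_n(\omega)=P(\omega)=0^{\mathbb{Z}^d}$ for all $n$. *)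

theory Defs
  imports "HOL-Probability.Probability"
begin

text \<open>The lattice of dimension \<open>d\<close> is \<open>int ^ 'd\<close> with \<open>d = CARD('d)\<close>, which is at least 1.
  Configurations are functions to \<open>nat\<close> with values in \<open>{0, 1}\<close>.\<close>

type_synonym 'd config = "int ^ 'd \<Rightarrow> nat"

definition sup_norm :: "int ^ 'd::finite \<Rightarrow> int" where
  "sup_norm x = Max (range (\<lambda>i. \<bar>x $ i\<bar>))"

definition lattice_box :: "nat \<Rightarrow> (int ^ 'd::finite) set" where
  "lattice_box n = {x. \<forall>i. x $ i \<in> {- int n..int n}}"

definition omega_measure :: "(int ^ 'd::finite \<Rightarrow> real) measure" where
  "omega_measure = Pi\<^sub>M UNIV (\<lambda>_. restrict_space lborel {0<..<1})"

definition config_topology :: "('d::finite) config topology" where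
  "config_topology = product_topology (\<lambda>_. discrete_topology {0, 1}) UNIV"

text \<open>A configuration on the box of radius \<open>\<nu>\<close> is an extensional function on that box.\<close>

definition parking_scheme :: "nat \<Rightarrow> ('d::finite) config set \<Rightarrow> bool" where
  "parking_scheme \<nu> S \<longleftrightarrow> S \<subseteq> (lattice_box \<nu> \<rightarrow>\<^sub>E {0, 1}) \<and> (\<lambda>z\<in>lattice_box \<nu>. 0) \<in> S"

definition translation :: "int ^ 'd::finite \<Rightarrow> 'd config \<Rightarrow> 'd config" where
  "translation x \<eta> = (\<lambda>z. \<eta> (z + x))"

definition park_step ::
    "nat \<Rightarrow> ('d::finite) config set \<Rightarrow> int ^ 'd \<Rightarrow> 'd config \<Rightarrow> 'd config" where
  "park_step \<nu> S x \<eta> = (if restrict (translation x \<eta>) (lattice_box \<nu>) \<in> S then \<eta>(x := 1) else \<eta>)"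

text \<open>The jamming limit on \<open>X\<close>. It has the intended meaning only when \<open>X\<close> is finite and \<open>\<omega>\<close> has
  pairwise distinct coordinates: then \<open>sorted_key_list_of_set \<omega> X\<close> lists the sites of \<open>X\<close> once
  each, in increasing order of \<open>\<omega>\<close>.\<close>

definition parking ::
    "nat \<Rightarrow> ('d::finite) config set \<Rightarrow> (int ^ 'd) set \<Rightarrow> (int ^ 'd \<Rightarrow> real) \<Rightarrow> 'd config" where
  "parking \<nu> S X \<omega> = fold (park_step \<nu> S) (sorted_key_list_of_set \<omega> X) (\<lambda>_. 0)"

text \<open>The sequence \<open>(p i)\<close> for \<open>0 \<le> i \<le> m\<close>; values of \<open>p\<close> beyond \<open>m\<close> are irrelevant.\<close>

definition decreasing_path ::
    "nat \<Rightarrow> (int ^ 'd::finite \<Rightarrow> real) \<Rightarrow> nat \<Rightarrow> (nat \<Rightarrow> int ^ 'd) \<Rightarrow> bool" where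
  "decreasing_path \<nu> \<omega> m p \<longleftrightarrow>
     (\<forall>i<m. sup_norm (p (Suc i) - p i) \<le> int \<nu> \<and> \<omega> (p i) > \<omega> (p (Suc i)))"

definition infinite_decreasing_path ::
    "nat \<Rightarrow> (int ^ 'd::finite \<Rightarrow> real) \<Rightarrow> (nat \<Rightarrow> int ^ 'd) \<Rightarrow> bool" where
  "infinite_decreasing_path \<nu> \<omega> p \<longleftrightarrow>
     (\<forall>i. sup_norm (p (Suc i) - p i) \<le> int \<nu> \<and> \<omega> (p i) > \<omega> (p (Suc i)))"

text \<open>\<open>leads_to \<nu> \<omega> y x\<close>: there is a decreasing path from \<open>x\<close> to \<open>y\<close>.\<close>

definition leads_to ::
    "nat \<Rightarrow> (int ^ 'd::finite \<Rightarrow> real) \<Rightarrow> int ^ 'd \<Rightarrow> int ^ 'd \<Rightarrow> bool" where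
  "leads_to \<nu> \<omega> y x \<longleftrightarrow> (\<exists>m p. decreasing_path \<nu> \<omega> m p \<and> p 0 = x \<and> p m = y)"

definition armour ::
    "nat \<Rightarrow> (int ^ 'd::finite) set \<Rightarrow> (int ^ 'd \<Rightarrow> real) \<Rightarrow> (int ^ 'd) set" where
  "armour \<nu> X \<omega> = {y. \<exists>x\<in>X. leads_to \<nu> \<omega> y x}"

text \<open>Off this exceptional set every armour of a single site is finite, by Koenig's lemma, so that
  \<open>parking\<close> is only ever used below on finite sets. On it, all jamming limits are set to zero.\<close>

definition exceptional :: "nat \<Rightarrow> (int ^ 'd::finite \<Rightarrow> real) \<Rightarrow> bool" where
  "exceptional \<nu> \<omega> \<longleftrightarrow> \<not> inj \<omega> \<or> (\<exists>p. infinite_decreasing_path \<nu> \<omega> p)"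

definition box_parking ::
    "nat \<Rightarrow> ('d::finite) config set \<Rightarrow> nat \<Rightarrow> (int ^ 'd \<Rightarrow> real) \<Rightarrow> 'd config" where
  "box_parking \<nu> S n \<omega> = (if exceptional \<nu> \<omega> then (\<lambda>_. 0) else parking \<nu> S (lattice_box n) \<omega>)"

definition limit_parking ::
    "nat \<Rightarrow> ('d::finite) config set \<Rightarrow> (int ^ 'd \<Rightarrow> real) \<Rightarrow> 'd config" where
  "limit_parking \<nu> S \<omega> =
     (if exceptional \<nu> \<omega> then (\<lambda>_. 0) else (\<lambda>x. parking \<nu> S (armour \<nu> {x} \<omega>) \<omega> x))"

end

theory Submission
  imports Defs
begin

text \<open>
  Convergence holds for every \<open>\<omega>\<close>, not merely almost every one. On the exceptional set all the
  configurations are zero by convention. Off it, the reason is that the dynamics is local: whether a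
  site \<open>x\<close> is occupied in the jamming limit is decided when \<open>x\<close> is visited, and at that time the
  configuration around \<open>x\<close> involves only neighbours with smaller \<open>\<omega>\<close>, whose state is already final
  (lemma \<open>parking_eq\<close>). Hence the jamming limit satisfies an equation that determines its
  value at \<open>x\<close> from its values at those neighbours, and this equation does not mention the set \<open>X\<close>
  of visited sites. Unfolding it recursively reaches exactly the armour of \<open>x\<close>, so all finite sets
  that contain this armour give the same value at \<open>x\<close> (lemma \<open>parking_eq_if_armour_subset\<close>).

  The recursion is well-founded because there is no infinite decreasing path; since a site has
  finitely many neighbours, Koenig's lemma makes the armour of \<open>x\<close> finite
  (lemma \<open>finite_armour\<close>). It is thus contained in all large boxes, and \<open>P\<^sub>n(\<omega>)(x)\<close> is
  eventually equal to \<open>P(\<omega>)(x)\<close>; in the product of discrete topologies this is convergence.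
\<close>

section \<open>Boxes of the lattice\<close>

lemma finite_lattice_box: "finite (lattice_box n :: (int ^ 'd::finite) set)"
proof (rule finite_subset)
  show "lattice_box n \<subseteq> vec_lambda ` ((UNIV :: 'd set) \<rightarrow>\<^sub>E {- int n..int n})"
  proof
    fix x :: "int ^ 'd"
    assume "x \<in> lattice_box n"
    then have "vec_nth x \<in> UNIV \<rightarrow>\<^sub>E {- int n..int n}"
      by (auto simp: lattice_box_def)
    then show "x \<in> vec_lambda ` (UNIV \<rightarrow>\<^sub>E {- int n..int n})"
      by (metis imageI vec_nth_inverse)
  qed
qed (simp add: finite_PiE)

lemma sup_norm_le_iff: "sup_norm x \<le> int n \<longleftrightarrow> x \<in> lattice_box n"
  by (auto simp: sup_norm_def lattice_box_def abs_le_iff minus_le_iff)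

lemma finite_subset_lattice_box:
  assumes "finite (A :: (int ^ 'd::finite) set)"
  obtains N where "\<And>n. N \<le> n \<Longrightarrow> A \<subseteq> lattice_box n"
proof
  fix n
  assume n: "nat (Max (insert 0 (sup_norm ` A))) \<le> n"
  show "A \<subseteq> lattice_box n"
  proof
    fix x
    assume "x \<in> A"
    then have "sup_norm x \<le> Max (insert 0 (sup_norm ` A))"
      using assms by (intro Max_ge) auto
    then show "x \<in> lattice_box n"
      using n by (simp flip: sup_norm_le_iff)
  qed
qed

section \<open>Armours\<close>

definition lower_neighbours :: "nat \<Rightarrow> (int ^ 'd::finite \<Rightarrow> real) \<Rightarrow> (int ^ 'd) rel" where
  "lower_neighbours \<nu> \<omega> = {(y, x). y - x \<in> lattice_box \<nu> \<and> \<omega> y < \<omega> x}"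

lemma wf_lower_neighbours:
  assumes "\<not> exceptional \<nu> \<omega>"
  shows "wf (lower_neighbours \<nu> \<omega>)"
  using assms
  by (auto simp: wf_iff_no_infinite_down_chain exceptional_def infinite_decreasing_path_def
      lower_neighbours_def sup_norm_le_iff)

lemma armour_singleton: "armour \<nu> {x} \<omega> = {y. (y, x) \<in> (lower_neighbours \<nu> \<omega>)\<^sup>*}"
proof -
  have "leads_to \<nu> \<omega> y x \<longleftrightarrow> (x, y) \<in> ((lower_neighbours \<nu> \<omega>)\<inverse>)\<^sup>*" for y
    unfolding leads_to_def rtrancl_power relpow_fun_conv decreasing_path_def
    by (auto simp: lower_neighbours_def sup_norm_le_iff)
  then show ?thesis
    by (simp add: armour_def rtrancl_converse)
qed

lemma self_in_armour: "x \<in> armour \<nu> {x} \<omega>"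
  by (simp add: armour_singleton)

lemma armour_lower_neighbour_subset:
  assumes "(y, x) \<in> lower_neighbours \<nu> \<omega>"
  shows "armour \<nu> {y} \<omega> \<subseteq> armour \<nu> {x} \<omega>"
  using assms by (auto simp: armour_singleton)

text \<open>Koenig's lemma, as an induction along the well-founded relation: the armour of \<open>x\<close> consists
  of \<open>x\<close> and the armours of its finitely many lower neighbours.\<close>

lemma finite_armour:
  assumes "\<not> exceptional \<nu> \<omega>"
  shows "finite (armour \<nu> {x} \<omega>)"
  using wf_lower_neighbours[OF assms]
proof (induction x)
  case (less x)
  let ?N = "{y. (y, x) \<in> lower_neighbours \<nu> \<omega>}"
  have "?N \<subseteq> (\<lambda>z. z + x) ` lattice_box \<nu>"
  proof
    fix y
    assume "y \<in> ?N"
    then have "y - x \<in> lattice_box \<nu>" "y = (y - x) + x"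
      by (simp_all add: lower_neighbours_def)
    then show "y \<in> (\<lambda>z. z + x) ` lattice_box \<nu>"
      by blast
  qed
  then have "finite ?N"
    using finite_lattice_box finite_surj by blast
  then have "finite (insert x (\<Union>y\<in>?N. armour \<nu> {y} \<omega>))"
    using less by auto
  moreover have "armour \<nu> {x} \<omega> \<subseteq> insert x (\<Union>y\<in>?N. armour \<nu> {y} \<omega>)"
    by (auto simp: armour_singleton elim: rtranclE)
  ultimately show ?case
    by (rule rev_finite_subset)
qed

section \<open>The local equation of a jamming limit\<close>

text \<open>The part of the final configuration that is already present when \<open>x\<close> is visited, seen
  from \<open>x\<close>.\<close>

definition seen_before ::
    "nat \<Rightarrow> (int ^ 'd::finite \<Rightarrow> real) \<Rightarrow> int ^ 'd \<Rightarrow> 'd config \<Rightarrow> 'd config" where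
  "seen_before \<nu> \<omega> x \<eta> = (\<lambda>z\<in>lattice_box \<nu>. if \<omega> (z + x) < \<omega> x then \<eta> (z + x) else 0)"

lemma seen_before_cong:
  assumes "\<And>y. (y, x) \<in> lower_neighbours \<nu> \<omega> \<Longrightarrow> \<eta> y = \<zeta> y"
  shows "seen_before \<nu> \<omega> x \<eta> = seen_before \<nu> \<omega> x \<zeta>"
  using assms by (auto simp: seen_before_def lower_neighbours_def intro!: restrict_ext)

text \<open>Visiting one more site \<open>a\<close>, later than all others, changes the configuration only at \<open>a\<close>,
  which no earlier site has seen; and what \<open>a\<close> sees is the whole current configuration, since this
  is zero at \<open>a\<close> and at every site yet to come. So the equation survives each step.\<close>

lemma fold_park_step:
  fixes \<nu> :: nat and S :: "('d::finite) config set"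
  assumes "sorted_wrt (\<lambda>x y. \<omega> x < \<omega> y) xs"
  defines "\<eta> \<equiv> fold (park_step \<nu> S) xs (\<lambda>_. 0)"
  shows "\<eta> x = (if x \<in> set xs \<and> seen_before \<nu> \<omega> x \<eta> \<in> S then 1 else 0)"
  using assms(1) unfolding \<eta>_def
proof (induction xs arbitrary: x rule: rev_induct)
  case Nil
  then show ?case by simp
next
  case (snoc a xs)
  let ?\<eta> = "fold (park_step \<nu> S) xs (\<lambda>_. 0)"
  let ?\<eta>' = "park_step \<nu> S a ?\<eta>"
  have less_a: "\<omega> y < \<omega> a" if "y \<in> set xs" for y
    using snoc.prems that by (simp add: sorted_wrt_append)
  have IH: "?\<eta> y = (if y \<in> set xs \<and> seen_before \<nu> \<omega> y ?\<eta> \<in> S then 1 else 0)" for y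
    using snoc by (simp add: sorted_wrt_append)
  have unchanged: "?\<eta>' y = ?\<eta> y" if "y \<noteq> a" for y
    using that by (simp add: park_step_def)
  have seen_unchanged: "seen_before \<nu> \<omega> y ?\<eta>' = seen_before \<nu> \<omega> y ?\<eta>" if "\<omega> y \<le> \<omega> a" for y
    using that unchanged by (intro seen_before_cong) (force simp: lower_neighbours_def)
  have zero: "?\<eta> y = 0" if "\<not> \<omega> y < \<omega> a" for y
    using IH[of y] less_a that by auto
  have "restrict (translation a ?\<eta>) (lattice_box \<nu>) = seen_before \<nu> \<omega> a ?\<eta>"
    by (auto simp: seen_before_def translation_def zero intro!: restrict_ext)
  then have at_a: "?\<eta>' a = (if seen_before \<nu> \<omega> a ?\<eta> \<in> S then 1 else 0)"
    using zero[of a] by (simp add: park_step_def)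
  have "?\<eta>' x = (if x \<in> set (xs @ [a]) \<and> seen_before \<nu> \<omega> x ?\<eta>' \<in> S then 1 else 0)"
  proof (cases "x = a")
    case True
    then show ?thesis
      using at_a seen_unchanged[of a] by simp
  next
    case False
    then show ?thesis
      using unchanged[of x] IH[of x] seen_unchanged[of x] less_a[of x] by auto
  qed
  then show ?case by simp
qed

lemma (in linorder) sorted_key_list_of_set_inj:
  assumes "finite X" and "inj f"
  shows sorted_wrt_sorted_key_list_of_set: "sorted_wrt (\<lambda>x y. f x < f y) (sorted_key_list_of_set f X)"
    and set_sorted_key_list_of_set_inj: "set (sorted_key_list_of_set f X) = X"
proof -
  interpret folding_insort_key "(\<le>)" "(<)" UNIV f
    by unfold_locales (use assms in auto)
  show "sorted_wrt (\<lambda>x y. f x < f y) (sorted_key_list_of_set f X)"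
    using strict_sorted_key_list_of_set[of X] by (simp add: sorted_wrt_map)
  show "set (sorted_key_list_of_set f X) = X"
    using assms by simp
qed

lemma parking_eq:
  assumes "finite X" and "inj \<omega>"
  shows "parking \<nu> S X \<omega> x =
    (if x \<in> X \<and> seen_before \<nu> \<omega> x (parking \<nu> S X \<omega>) \<in> S then 1 else 0)"
  using fold_park_step[OF sorted_wrt_sorted_key_list_of_set[OF assms], of \<nu> S x]
  by (simp add: parking_def set_sorted_key_list_of_set_inj[OF assms])

lemma parking_in_01:
  assumes "finite X" and "inj \<omega>"
  shows "parking \<nu> S X \<omega> x \<in> {0, 1}"
  by (subst parking_eq[OF assms]) simp

text \<open>By the local equation, two jamming limits agree at \<open>x\<close> as soon as they agree at the lower
  neighbours of \<open>x\<close>; the armours of these are contained in the armour of \<open>x\<close>, which lets the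
  hypotheses pass down the induction.\<close>

lemma parking_eq_if_armour_subset:
  assumes "\<not> exceptional \<nu> \<omega>" and fin: "finite X" "finite Y"
    and "armour \<nu> {x} \<omega> \<subseteq> X" "armour \<nu> {x} \<omega> \<subseteq> Y"
  shows "parking \<nu> S X \<omega> x = parking \<nu> S Y \<omega> x"
  using wf_lower_neighbours[OF assms(1)] assms(4,5)
proof (induction x)
  case (less x)
  have inj: "inj \<omega>"
    using assms(1) by (simp add: exceptional_def)
  have "seen_before \<nu> \<omega> x (parking \<nu> S X \<omega>) = seen_before \<nu> \<omega> x (parking \<nu> S Y \<omega>)"
    using less armour_lower_neighbour_subset by (intro seen_before_cong) blast
  moreover have "x \<in> X" "x \<in> Y"
    using less.prems self_in_armour by blast+
  ultimately show ?case
    using parking_eq[OF fin(1) inj, of \<nu> S x] parking_eq[OF fin(2) inj, of \<nu> S x] by simp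
qed

section \<open>Convergence\<close>

lemma limitin_discrete_topology:
  "limitin (discrete_topology U) f l F \<longleftrightarrow> l \<in> U \<and> (\<forall>\<^sub>F n in F. f n = l)"
proof
  assume "limitin (discrete_topology U) f l F"
  then have "l \<in> U" and "openin (discrete_topology U) {l} \<Longrightarrow> \<forall>\<^sub>F n in F. f n \<in> {l}"
    unfolding limitin_def by auto
  then show "l \<in> U \<and> (\<forall>\<^sub>F n in F. f n = l)"
    by simp
qed (auto simp: limitin_def elim: eventually_mono)

lemma limitin_config_topologyI:
  assumes "\<And>n x. f n x \<in> {0, 1}" and "\<And>x. l x \<in> {0, 1}"
    and "\<And>x. \<forall>\<^sub>F n in F. f n x = l x"
  shows "limitin config_topology f l F"
  unfolding config_topology_def limitin_componentwise limitin_discrete_topology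
  using assms by (auto simp: PiE_iff)

theorem theorem3p3:
  fixes \<nu> :: nat and S :: "('d::finite) config set"
  assumes "\<nu> \<ge> 1" and "parking_scheme \<nu> S"
  shows "AE \<omega> in omega_measure.
    limitin config_topology (\<lambda>n. box_parking \<nu> S n \<omega>) (limit_parking \<nu> S \<omega>) sequentially"
proof (rule AE_I2)
  fix \<omega> :: "int ^ 'd \<Rightarrow> real"
  show "limitin config_topology (\<lambda>n. box_parking \<nu> S n \<omega>) (limit_parking \<nu> S \<omega>) sequentially"
  proof (cases "exceptional \<nu> \<omega>")
    case True
    then show ?thesis
      by (intro limitin_config_topologyI) (simp_all add: box_parking_def limit_parking_def)
  next
    case False
    then have inj: "inj \<omega>"
      by (simp add: exceptional_def)
    have fin: "finite (armour \<nu> {x} \<omega>)" for x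
      using False by (rule finite_armour)
    show ?thesis
    proof (rule limitin_config_topologyI)
      fix n x
      show "box_parking \<nu> S n \<omega> x \<in> {0, 1}"
        using False parking_in_01[OF finite_lattice_box inj] by (simp add: box_parking_def)
    next
      fix x
      show "limit_parking \<nu> S \<omega> x \<in> {0, 1}"
        using False parking_in_01[OF fin inj] by (simp add: limit_parking_def)
    next
      fix x
      obtain N where N: "\<And>n. N \<le> n \<Longrightarrow> armour \<nu> {x} \<omega> \<subseteq> lattice_box n"
        using finite_subset_lattice_box[OF fin] by blast
      have "box_parking \<nu> S n \<omega> x = limit_parking \<nu> S \<omega> x" if "N \<le> n" for n
        using False parking_eq_if_armour_subset[OF False finite_lattice_box fin N[OF that] order_refl]
        by (simp add: box_parking_def limit_parking_def)
      then show "\<forall>\<^sub>F n in sequentially. box_parking \<nu> S n \<omega> x = limit_parking \<nu> S \<omega> x"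
        by (rule eventually_sequentiallyI)
    qed
  qed
qed

end
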